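(* Let $\mathcal{C}$ be a hereditary class of finite simple graphs and let $f:\mathcal{C}\to\mathbb{R}$ be a function satisfying: (1) $f(G)\le |V(G)|$ whenever $G\in\mathcal{C}$ has no edges (i.e. $G$ is a collection of isolated vertices); and, for every $G\in\mathcal{C}$ with at least one edge, there exists a nonempty sequence of vertices $v_1,\dots,v_k$ of $G$ such that, setting $G_0=G$ and $G_i=G-v_1-v_2-\cdots-v_i$ for $0\le i\le k$: (2) $f(G_i-\operatorname{st}_{G_i}v_{i+1})+1\ge f(G)$ for all $0\le i\le k-1$; (3) $f(\overline{G_k})+|\operatorname{is}(G_k)|\ge f(G)$. Then for every graph $G\in\mathcal{C}$, \[\operatorname{pd}(G)\le |V(G)|-f(G).\]
   Context: All graphs are finite and simple. A class $\mathcal{C}$ of graphs is hereditary if $G-x\in\mathcal{C}$ whenever $G\in\mathcal{C}$ and $x$ is a vertex of $G$ (here $G-x$ is the induced subgraph on $V(G)\setminus\{x\}$). For a graph $H$ and a vertex $v$, $\operatorname{st}_H v$ is the induced subgraph of $H$ on $v$ together with its neighbors in $H$, and $H-\operatorname{st}_H v$ denotes $H$ with these vertices deleted. $\operatorname{is}(H)$ is the set of isolated vertices of $H$ and $\overline{H}=H-\operatorname{is}(H)$. For a graph $G$ with vertex set $\{x_1,\dots,x_n\}$ and a fixed field $\mathbf{k}$, let $S=\mathbf{k}[x_1,\dots,x_n]$ and let $I(G)=(x_ix_j : (x_i,x_j)\text{ an edge of }G)$ be the edge ideal; $\operatorname{pd}(G)$ denotes the projective dimension of $S/I(G)$ over $S$.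 *)

theory Defs
  imports Complex_Main "HOL-Library.Poly_Mapping"
begin

text \<open>A graph is a pair (V, E) of a vertex set and a set of ordered pairs;
  an undirected edge {u,v} is represented by both (u,v) and (v,u).\<close>

type_synonym 'v graph = "'v set \<times> ('v \<times> 'v) set"

definition verts :: "'v graph \<Rightarrow> 'v set" where "verts G = fst G"
definition edges :: "'v graph \<Rightarrow> ('v \<times> 'v) set" where "edges G = snd G"

definition simple_graph :: "'v graph \<Rightarrow> bool" where
  "simple_graph G \<longleftrightarrow> finite (verts G) \<and> edges G \<subseteq> verts G \<times> verts G
     \<and> sym (edges G) \<and> irrefl (edges G)"

definition induced :: "'v graph \<Rightarrow> 'v set \<Rightarrow> 'v graph" where
  "induced G W = (verts G \<inter> W, edges G \<inter> (W \<times> W))"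

definition del_vertex :: "'v graph \<Rightarrow> 'v \<Rightarrow> 'v graph" where
  "del_vertex G x = induced G (verts G - {x})"

definition del_vertices :: "'v graph \<Rightarrow> 'v list \<Rightarrow> 'v graph" where
  "del_vertices G xs = foldl del_vertex G xs"

definition star_verts :: "'v graph \<Rightarrow> 'v \<Rightarrow> 'v set" where
  "star_verts H v = {v} \<union> {u \<in> verts H. (v, u) \<in> edges H}"

definition star :: "'v graph \<Rightarrow> 'v \<Rightarrow> 'v graph" where
  "star H v = induced H (star_verts H v)"

definition del_star :: "'v graph \<Rightarrow> 'v \<Rightarrow> 'v graph" where
  "del_star H v = induced H (verts H - star_verts H v)"

definition isolated :: "'v graph \<Rightarrow> 'v set" where
  "isolated H = {v \<in> verts H. \<forall>u. (v, u) \<notin> edges H}"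

definition del_isolated :: "'v graph \<Rightarrow> 'v graph" where
  "del_isolated H = induced H (verts H - isolated H)"

definition hereditary :: "'v graph set \<Rightarrow> bool" where
  "hereditary C \<longleftrightarrow> (\<forall>G\<in>C. \<forall>x\<in>verts G. del_vertex G x \<in> C)"

text \<open>Multivariate polynomials over 'k in variables indexed by 'v:
  maps from monomials (exponent vectors 'v \<Rightarrow>0 nat) to coefficients.\<close>

type_synonym ('v, 'k) mpoly = "('v \<Rightarrow>\<^sub>0 nat) \<Rightarrow>\<^sub>0 'k"

definition Var :: "'v \<Rightarrow> ('v, 'k::comm_ring_1) mpoly" where
  "Var v = Poly_Mapping.single (Poly_Mapping.single v 1) 1"

definition polyring :: "'v set \<Rightarrow> ('v, 'k::comm_ring_1) mpoly set" where
  "polyring V = {p. \<forall>m \<in> Poly_Mapping.keys p. Poly_Mapping.keys m \<subseteq> V}"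

definition edge_ideal :: "'v graph \<Rightarrow> ('v, 'k::comm_ring_1) mpoly set" where
  "edge_ideal G = {p. \<exists>c. (\<forall>e \<in> edges G. c e \<in> polyring (verts G)) \<and>
      p = (\<Sum>e\<in>edges G. c e * (Var (fst e) * Var (snd e)))}"

definition free_mod :: "'v set \<Rightarrow> nat \<Rightarrow> (nat \<Rightarrow> ('v, 'k::comm_ring_1) mpoly) set" where
  "free_mod V b = {x. (\<forall>i<b. x i \<in> polyring V) \<and> (\<forall>i\<ge>b. x i = 0)}"

definition mat_apply :: "nat \<Rightarrow> nat \<Rightarrow> (nat \<Rightarrow> nat \<Rightarrow> ('v, 'k::comm_ring_1) mpoly)
    \<Rightarrow> (nat \<Rightarrow> ('v, 'k) mpoly) \<Rightarrow> (nat \<Rightarrow> ('v, 'k) mpoly)" where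
  "mat_apply a b M x = (\<lambda>r. if r < a then (\<Sum>c<b. M r c * x c) else 0)"

definition is_matrix :: "'v set \<Rightarrow> nat \<Rightarrow> nat \<Rightarrow> (nat \<Rightarrow> nat \<Rightarrow> ('v, 'k::comm_ring_1) mpoly) \<Rightarrow> bool" where
  "is_matrix V a b M \<longleftrightarrow> (\<forall>r<a. \<forall>c<b. M r c \<in> polyring V)"

text \<open>A free resolution of S/I(G) of length n:
  0 \<rightarrow> S^(b n) \<rightarrow> ... \<rightarrow> S^(b 1) \<rightarrow> S^(b 0) = S \<rightarrow> S/I(G) \<rightarrow> 0,
  where d i : S^(b i) \<rightarrow> S^(b (i-1)) for 1 \<le> i \<le> n.  Exactness at S^(b 0) = S means
  ker(S \<rightarrow> S/I) = I(G) equals the image of d 1 (for n = 0: I(G) = 0);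
  exactness at S^(b i), 1 \<le> i < n: ker d i = im d (i+1);
  exactness at S^(b n): d n injective.\<close>

definition ker_at :: "'v graph \<Rightarrow> (nat \<Rightarrow> nat) \<Rightarrow> (nat \<Rightarrow> nat \<Rightarrow> nat \<Rightarrow> ('v, 'k::comm_ring_1) mpoly)
    \<Rightarrow> nat \<Rightarrow> (nat \<Rightarrow> ('v, 'k) mpoly) set" where
  "ker_at G b d i =
     (if i = 0 then {x \<in> free_mod (verts G) 1. x 0 \<in> edge_ideal G}
      else {x \<in> free_mod (verts G) (b i). mat_apply (b (i - 1)) (b i) (d i) x = (\<lambda>_. 0)})"

definition free_resolution :: "'v graph \<Rightarrow> nat \<Rightarrow> (nat \<Rightarrow> nat)
    \<Rightarrow> (nat \<Rightarrow> nat \<Rightarrow> nat \<Rightarrow> ('v, 'k::comm_ring_1) mpoly) \<Rightarrow> bool" where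
  "free_resolution G n b d \<longleftrightarrow>
     b 0 = 1 \<and>
     (\<forall>i\<in>{1..n}. is_matrix (verts G) (b (i - 1)) (b i) (d i)) \<and>
     (\<forall>i<n. ker_at G b d i = mat_apply (b i) (b (Suc i)) (d (Suc i)) ` free_mod (verts G) (b (Suc i))) \<and>
     ker_at G b d n = {\<lambda>_. 0}"

text \<open>pd(G) = projective dimension of S/I(G) over S, i.e. the minimal length of a
  (finite) free resolution of S/I(G); the field is given by the type 'k.\<close>
definition pd :: "'k::field itself \<Rightarrow> 'v graph \<Rightarrow> nat" where
  "pd (TYPE('k)) G = (LEAST n. \<exists>b (d :: nat \<Rightarrow> nat \<Rightarrow> nat \<Rightarrow> ('v, 'k) mpoly). free_resolution G n b d)"

end

theory Submission
  imports Defs "HOL-Library.Function_Algebras"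
begin

text \<open>
  Let \<open>x\<close> be a vertex of \<open>H\<close>, let \<open>I' = I(H - x)\<close>, and let \<open>J\<close> be generated by \<open>I(H - st x)\<close> together
  with the neighbours of \<open>x\<close>. Then \<open>I' \<subseteq> J\<close> and \<open>I(H) = I' + x J\<close>, and since \<open>x\<close> is a nonzerodivisor
  modulo \<open>I'\<close>, the sequence \<open>0 \<rightarrow> I' \<rightarrow> I' \<oplus> J \<rightarrow> I(H) \<rightarrow> 0\<close> with maps \<open>a \<mapsto> (x a, -a)\<close> and
  \<open>(a, b) \<mapsto> a + x b\<close> is exact. Taking \<open>J = S\<close>, the same sequence shows that adding a new variable to a
  monomial ideal raises the projective dimension by at most one. Hence
  \<open>pd H \<le> max (pd (H - x) + 1) (pd (H - st x) + deg x)\<close>, and iterating this along \<open>v\<^sub>1, \<dots>, v\<^sub>k\<close> gives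
  the theorem by induction on the number of vertices. All ideals are taken in the polynomial ring on
  the vertices of the original graph, so the ring never changes.
\<close>

section \<open>Vectors and linear combinations over a commutative ring\<close>

definition smul :: "'a::comm_ring_1 \<Rightarrow> (nat \<Rightarrow> 'a) \<Rightarrow> (nat \<Rightarrow> 'a)" where
  "smul r x = (\<lambda>i. r * x i)"

text \<open>The vectors \<open>g c\<close> are the columns of a matrix, so this is that matrix
  applied to \<open>x\<close>. The first index of \<open>g\<close> is the column, opposite to the
  convention of \<open>mat_apply\<close>.\<close>

definition lincomb :: "nat \<Rightarrow> (nat \<Rightarrow> nat \<Rightarrow> 'a::comm_ring_1) \<Rightarrow> (nat \<Rightarrow> 'a) \<Rightarrow> (nat \<Rightarrow> 'a)" where
  "lincomb b g x = (\<Sum>c<b. smul (x c) (g c))"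

text \<open>The cut-off \<open>a\<close> is explicit because vectors carry no length; the first
  component can be recovered only if it vanishes from \<open>a\<close> on.\<close>

definition join :: "nat \<Rightarrow> (nat \<Rightarrow> 'a::comm_ring_1) \<Rightarrow> (nat \<Rightarrow> 'a) \<Rightarrow> (nat \<Rightarrow> 'a)" where
  "join a x y = (\<lambda>i. if i < a then x i else y (i - a))"

definition left_part :: "nat \<Rightarrow> (nat \<Rightarrow> 'a::comm_ring_1) \<Rightarrow> (nat \<Rightarrow> 'a)" where
  "left_part a z = (\<lambda>i. if i < a then z i else 0)"

definition right_part :: "nat \<Rightarrow> (nat \<Rightarrow> 'a::comm_ring_1) \<Rightarrow> (nat \<Rightarrow> 'a)" where
  "right_part a z = (\<lambda>i. z (a + i))"

definition direct_sum :: "nat \<Rightarrow> (nat \<Rightarrow> 'a::comm_ring_1) set \<Rightarrow> (nat \<Rightarrow> 'a) set \<Rightarrow> (nat \<Rightarrow> 'a) set" where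
  "direct_sum a A B = {join a x y | x y. x \<in> A \<and> y \<in> B}"

definition unit_vec :: "nat \<Rightarrow> nat \<Rightarrow> 'a::comm_ring_1" where
  "unit_vec c = (\<lambda>i. if i = c then 1 else 0)"

lemma smul_apply: "smul r x i = r * x i"
  by (simp add: smul_def)

(* Induction eta-expands function-valued terms; as simp rules these equations would then
   unfold every vector pointwise. *)
lemmas vec_apply = smul_apply plus_fun_apply zero_fun_apply uminus_apply minus_apply
declare vec_apply [simp del]

lemma smul_simps [simp]:
  "smul 0 x = 0" "smul r 0 = 0" "smul 1 x = x" "smul (-1) x = - x"
  by (auto simp: fun_eq_iff vec_apply)

lemma smul_algebra:
  "smul r (x + y) = smul r x + smul r y"
  "smul (r + s) x = smul r x + smul s x"
  "smul r (smul s x) = smul (r * s) x"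
  by (auto simp: fun_eq_iff vec_apply algebra_simps)

lemma smul_sum: "smul r (sum h A) = (\<Sum>c\<in>A. smul r (h c))"
  by (induction A rule: infinite_finite_induct) (simp_all add: smul_algebra)

lemma sum_fun_apply: "(sum h A) i = (\<Sum>c\<in>A. h c i)"
  for h :: "'b \<Rightarrow> nat \<Rightarrow> 'a::comm_ring_1"
  by (induction A rule: infinite_finite_induct) (auto simp: vec_apply)

lemma lincomb_apply: "lincomb b g x r = (\<Sum>c<b. g c r * x c)"
  by (simp add: lincomb_def sum_fun_apply vec_apply mult.commute)

lemma lincomb_add: "lincomb b g (x + y) = lincomb b g x + lincomb b g y"
  by (simp add: lincomb_def smul_algebra sum.distrib vec_apply)

lemma lincomb_smul: "lincomb b g (smul r x) = smul r (lincomb b g x)"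
  by (simp add: lincomb_def smul_algebra smul_sum vec_apply)

lemma lincomb_0 [simp]: "lincomb b g 0 = 0"
  by (simp add: lincomb_def vec_apply)

lemma lincomb_uminus: "lincomb b g (- x) = - lincomb b g x"
  using lincomb_smul[of b g "-1" x] by simp

lemma lincomb_unit_vec: "c < b \<Longrightarrow> lincomb b g (unit_vec c) = g c"
  by (simp add: fun_eq_iff vec_apply lincomb_apply unit_vec_def if_distrib cong: if_cong)

lemma lincomb_cong: "(\<And>c. c < b \<Longrightarrow> g c = h c) \<Longrightarrow> (\<And>c. c < b \<Longrightarrow> x c = y c) \<Longrightarrow> lincomb b g x = lincomb b h y"
  by (simp add: lincomb_def)

lemma lincomb_lincomb:
  "lincomb b g (lincomb a h x) = lincomb a (\<lambda>c. lincomb b g (h c)) x"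
proof
  fix r
  have "(\<Sum>c<b. g c r * (\<Sum>d<a. h d c * x d)) = (\<Sum>c<b. \<Sum>d<a. g c r * h d c * x d)"
    by (simp add: sum_distrib_left mult.assoc)
  also have "\<dots> = (\<Sum>d<a. \<Sum>c<b. g c r * h d c * x d)"
    by (rule sum.swap)
  finally show "lincomb b g (lincomb a h x) r = lincomb a (\<lambda>c. lincomb b g (h c)) x r"
    by (simp add: lincomb_apply sum_distrib_right)
qed

lemma left_join [simp]: "(\<And>i. i \<ge> a \<Longrightarrow> x i = 0) \<Longrightarrow> left_part a (join a x y) = x"
  by (auto simp: left_part_def join_def fun_eq_iff vec_apply)

lemma right_join [simp]: "right_part a (join a x y) = y"
  by (auto simp: right_part_def join_def fun_eq_iff vec_apply)

lemma join_parts [simp]: "join a (left_part a z) (right_part a z) = z"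
  by (auto simp: right_part_def left_part_def join_def fun_eq_iff vec_apply)

lemma join_linear:
  "join a (x + x') (y + y') = join a x y + join a x' y'"
  "join a (smul r x) (smul r y) = smul r (join a x y)"
  "join a 0 0 = 0"
  by (auto simp: join_def fun_eq_iff vec_apply)

lemma part_linear:
  "left_part a (x + y) = left_part a x + left_part a y"
  "left_part a (smul r x) = smul r (left_part a x)"
  "right_part a (x + y) = right_part a x + right_part a y"
  "right_part a (smul r x) = smul r (right_part a x)"
  by (auto simp: left_part_def right_part_def fun_eq_iff vec_apply)

text \<open>The family on the left is the block diagonal matrix with blocks \<open>g1\<close> and
  \<open>g2\<close>.\<close>

lemma lincomb_join:
  "lincomb (b1 + b2) (\<lambda>c. if c < b1 then join a (g1 c) 0 else join a 0 (g2 (c - b1))) z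
    = join a (lincomb b1 g1 (left_part b1 z)) (lincomb b2 g2 (right_part b1 z))"
proof
  fix r
  have split: "(\<Sum>c<b1+b2. h c) = (\<Sum>c<b1. h c) + (\<Sum>c<b2. h (b1 + c))" for h :: "nat \<Rightarrow> 'a"
    by (induction b2) (auto simp: add.assoc)
  show "lincomb (b1 + b2) (\<lambda>c. if c < b1 then join a (g1 c) 0 else join a 0 (g2 (c - b1))) z r
    = join a (lincomb b1 g1 (left_part b1 z)) (lincomb b2 g2 (right_part b1 z)) r"
    unfolding lincomb_apply split
    by (simp add: join_def lincomb_apply left_part_def right_part_def vec_apply)
qed

lemma lincomb_unit_family:
  assumes "\<And>i. i \<ge> b \<Longrightarrow> x i = 0" shows "lincomb b unit_vec x = x"
proof
  fix r
  have "(\<Sum>c<b. unit_vec c r * x c) = (\<Sum>c<b. if c = r then x c else 0)"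
    by (rule sum.cong) (auto simp: unit_vec_def)
  then show "lincomb b unit_vec x r = x r"
    using assms by (auto simp: lincomb_apply not_less)
qed

text \<open>Turns ring elements into vectors of length one, so that ideals are treated as submodules
  of a free module.\<close>

definition embed :: "'a::comm_ring_1 \<Rightarrow> nat \<Rightarrow> 'a" where
  "embed p = (\<lambda>i. if i = 0 then p else 0)"

lemma embed_linear:
  "embed (p + q) = embed p + embed q" "embed (r * p) = smul r (embed p)"
  "embed 0 = 0" "embed (- p) = - embed p"
  by (auto simp: embed_def fun_eq_iff vec_apply)

lemma embed_apply [simp]: "embed p 0 = p"
  by (simp add: embed_def)

section \<open>Free modules, submodules and syzygies over a subring\<close>

locale coeff_ring =
  fixes R :: "'a::comm_ring_1 set"
  assumes zero_mem: "0 \<in> R" and one_mem: "1 \<in> R"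
    and add_mem: "\<And>p q. p \<in> R \<Longrightarrow> q \<in> R \<Longrightarrow> p + q \<in> R"
    and mult_mem: "\<And>p q. p \<in> R \<Longrightarrow> q \<in> R \<Longrightarrow> p * q \<in> R"
    and uminus_mem: "\<And>p. p \<in> R \<Longrightarrow> - p \<in> R"
begin

text \<open>The carrier \<open>R\<close> is kept apart from the type, since the polynomials in the
  variables \<open>V\<close> form only a subring of all polynomials. Padding with 0 makes equality
  of vectors the same as equality of functions.\<close>

definition free :: "nat \<Rightarrow> (nat \<Rightarrow> 'a) set" where
  "free b = {x. (\<forall>i<b. x i \<in> R) \<and> (\<forall>i\<ge>b. x i = 0)}"

definition submod :: "(nat \<Rightarrow> 'a) set \<Rightarrow> bool" where
  "submod M \<longleftrightarrow> 0 \<in> M \<and> (\<forall>x\<in>M. \<forall>y\<in>M. x + y \<in> M) \<and> (\<forall>r\<in>R. \<forall>x\<in>M. smul r x \<in> M)"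

definition linear_on :: "(nat \<Rightarrow> 'a) set \<Rightarrow> ((nat \<Rightarrow> 'a) \<Rightarrow> (nat \<Rightarrow> 'a)) \<Rightarrow> bool" where
  "linear_on M h \<longleftrightarrow> (\<forall>x\<in>M. \<forall>y\<in>M. h (x + y) = h x + h y) \<and> (\<forall>r\<in>R. \<forall>x\<in>M. h (smul r x) = smul r (h x))"

definition syz :: "nat \<Rightarrow> (nat \<Rightarrow> nat \<Rightarrow> 'a) \<Rightarrow> (nat \<Rightarrow> 'a) set" where
  "syz b g = {x \<in> free b. lincomb b g x = 0}"

text \<open>\<open>resolvable n M\<close> means that \<open>M\<close> has a free resolution \<open>0 \<rightarrow> F\<^sub>n \<rightarrow> \<dots> \<rightarrow> F\<^sub>1 \<rightarrow> M \<rightarrow> 0\<close> with \<open>n\<close> terms,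
  so for an ideal \<open>I\<close> it says that the projective dimension of \<open>S/I\<close> (not of \<open>I\<close>) is at most \<open>n\<close>.\<close>

fun resolvable :: "nat \<Rightarrow> (nat \<Rightarrow> 'a) set \<Rightarrow> bool" where
  "resolvable 0 M \<longleftrightarrow> M = {0}"
| "resolvable (Suc n) M \<longleftrightarrow> (\<exists>b g. M = lincomb b g ` free b \<and> resolvable n (syz b g))"

lemma free_eqD: "x \<in> free b \<Longrightarrow> i \<ge> b \<Longrightarrow> x i = 0"
  by (simp add: free_def)

lemma mem_R: "x \<in> free b \<Longrightarrow> x i \<in> R"
  using zero_mem by (cases "i < b") (auto simp: free_def)

lemma submod_free: "submod (free b)"
  by (auto simp: submod_def free_def zero_mem add_mem mult_mem vec_apply)

lemma free_0: "free 0 = {0}"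
  by (auto simp: free_def fun_eq_iff vec_apply)

lemma unit_vec_free: "c < b \<Longrightarrow> unit_vec c \<in> free b"
  by (auto simp: free_def unit_vec_def zero_mem one_mem)

lemma submodD:
  assumes "submod M"
  shows "0 \<in> M" "x \<in> M \<Longrightarrow> y \<in> M \<Longrightarrow> x + y \<in> M" "r \<in> R \<Longrightarrow> x \<in> M \<Longrightarrow> smul r x \<in> M"
    "x \<in> M \<Longrightarrow> - x \<in> M"
proof -
  show "0 \<in> M" "x \<in> M \<Longrightarrow> y \<in> M \<Longrightarrow> x + y \<in> M" and s: "r \<in> R \<Longrightarrow> x \<in> M \<Longrightarrow> smul r x \<in> M" for r
    using assms by (auto simp: submod_def)
  show "x \<in> M \<Longrightarrow> - x \<in> M"
    using s[of "-1"] uminus_mem[OF one_mem] by simp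
qed

lemma linear_onD:
  assumes "linear_on M h"
  shows "x \<in> M \<Longrightarrow> y \<in> M \<Longrightarrow> h (x + y) = h x + h y"
    "r \<in> R \<Longrightarrow> x \<in> M \<Longrightarrow> h (smul r x) = smul r (h x)"
  using assms by (auto simp: linear_on_def)

lemma linear_on_0: "linear_on M h \<Longrightarrow> submod M \<Longrightarrow> h 0 = 0"
  using linear_onD(2)[of M h 0 0] submodD(1)[of M] zero_mem by simp

lemma lincomb_mem:
  assumes "submod M" "\<And>c. c < b \<Longrightarrow> g c \<in> M" "x \<in> free b"
  shows "lincomb b g x \<in> M"
proof -
  have "(\<Sum>c<k. smul (x c) (g c)) \<in> M" if "k \<le> b" for k
    using that
    by (induction k) (auto intro!: submodD[OF assms(1)] assms(2) mem_R[OF assms(3)])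
  then show ?thesis by (simp add: lincomb_def)
qed

lemma linear_on_lincomb:
  assumes "linear_on M h" "submod M" "\<And>c. c < b \<Longrightarrow> g c \<in> M" "x \<in> free b"
  shows "h (lincomb b g x) = lincomb b (\<lambda>c. h (g c)) x"
proof -
  have "(\<Sum>c<k. smul (x c) (g c)) \<in> M \<and>
      h (\<Sum>c<k. smul (x c) (g c)) = (\<Sum>c<k. smul (x c) (h (g c)))" if "k \<le> b" for k
    using that
  proof (induction k)
    case 0
    then show ?case
      using linear_on_0[OF assms(1,2)] submodD(1)[OF assms(2)] by simp
  next
    case (Suc k)
    have "smul (x k) (g k) \<in> M" "h (smul (x k) (g k)) = smul (x k) (h (g k))"
      using Suc.prems assms(2,3) mem_R[OF assms(4)]
      by (auto intro!: submodD[OF assms(2)] linear_onD(2)[OF assms(1)])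
    with Suc show ?case
      by (simp add: submodD[OF assms(2)] linear_onD(1)[OF assms(1)])
  qed
  then show ?thesis by (simp add: lincomb_def)
qed

lemma submod_image:
  assumes "submod M" "linear_on M h" shows "submod (h ` M)"
proof -
  have "h x + h y \<in> h ` M" if "x \<in> M" "y \<in> M" for x y
    using linear_onD(1)[OF assms(2), of x y] submodD(2)[OF assms(1), of x y] that
    by (metis image_eqI)
  moreover have "smul r (h x) \<in> h ` M" if "x \<in> M" "r \<in> R" for x r
    using linear_onD(2)[OF assms(2), of r x] submodD(3)[OF assms(1), of r x] that
    by (metis image_eqI)
  moreover have "0 \<in> h ` M"
    using linear_on_0[OF assms(2,1)] submodD(1)[OF assms(1)] by (metis image_eqI)
  ultimately show ?thesis by (auto simp: submod_def)
qed

lemma linear_on_lincomb_fun: "linear_on M (lincomb b g)"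
  by (simp add: linear_on_def lincomb_add lincomb_smul)

lemma submod_lincomb_image: "submod (lincomb b g ` free b)"
  by (intro submod_image submod_free linear_on_lincomb_fun)

lemma submod_0: "submod {0}"
  by (simp add: submod_def)

section \<open>Resolutions of isomorphic images, direct sums and cokernels\<close>

lemma resolvable_submod: "resolvable n M \<Longrightarrow> submod M"
  by (cases n) (auto simp: submod_0 submod_lincomb_image)

text \<open>The resolution is padded at its far end: the zero module is generated by the empty
  family, which has no nonzero syzygies.\<close>

lemma resolvable_Suc: "resolvable n M \<Longrightarrow> resolvable (Suc n) M"
proof (induction n arbitrary: M)
  case 0
  then have "M = lincomb 0 undefined ` free 0" "syz 0 undefined = {0}"
    by (auto simp: free_0 syz_def)
  then show ?case by (metis resolvable.simps)
next
  case (Suc n)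
  then show ?case by (metis resolvable.simps(2))
qed

lemma resolvable_mono: "resolvable n M \<Longrightarrow> n \<le> m \<Longrightarrow> resolvable m M"
  by (induction m rule: nat_induct) (auto simp: le_Suc_eq resolvable_Suc simp del: resolvable.simps)

lemma generator_mem: "c < b \<Longrightarrow> g c \<in> lincomb b g ` free b"
  using lincomb_unit_vec[of c b g] unit_vec_free[of c b] by (metis image_eqI)

lemma resolvable_free: "resolvable (Suc 0) (free b)"
proof -
  have "lincomb b unit_vec x = x" if "x \<in> free b" for x
    using that free_eqD by (intro lincomb_unit_family) auto
  then have "free b = lincomb b unit_vec ` free b" "syz b unit_vec = {0}"
    using submodD(1)[OF submod_free[of b]] by (auto simp: syz_def)
  then show ?thesis by (metis resolvable.simps)
qed

text \<open>Pushing the generators through an injective linear map leaves their syzygies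
  unchanged.\<close>

lemma resolvable_iso:
  assumes "resolvable n M" "linear_on M h" "\<And>x. x \<in> M \<Longrightarrow> h x = 0 \<Longrightarrow> x = 0"
  shows "resolvable n (h ` M)"
proof (cases n)
  case 0
  then show ?thesis using assms linear_on_0[OF assms(2)] submod_0 by simp
next
  case (Suc k)
  then obtain b g where M: "M = lincomb b g ` free b" and k: "resolvable k (syz b g)"
    using assms(1) by auto
  have h: "h (lincomb b g x) = lincomb b (\<lambda>c. h (g c)) x" if "x \<in> free b" for x
    using that generator_mem M assms(2) resolvable_submod[OF assms(1)]
    by (intro linear_on_lincomb) auto
  have "h ` M = lincomb b (\<lambda>c. h (g c)) ` free b"
    using h by (auto simp: M image_image)
  moreover have "syz b (\<lambda>c. h (g c)) = syz b g"
    using h assms(3) M linear_on_0[OF assms(2) resolvable_submod[OF assms(1)]]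
    by (fastforce simp: syz_def)
  ultimately show ?thesis using k Suc by (metis resolvable.simps(2))
qed

lemma left_part_free: "z \<in> free (a + b) \<Longrightarrow> left_part a z \<in> free a"
  by (auto simp: free_def left_part_def)

lemma right_part_free: "z \<in> free (a + b) \<Longrightarrow> right_part a z \<in> free b"
  by (auto simp: free_def right_part_def)

lemma join_free: "x \<in> free a \<Longrightarrow> y \<in> free b \<Longrightarrow> join a x y \<in> free (a + b)"
  by (auto simp: free_def join_def)

lemma left_join_free [simp]: "x \<in> free a \<Longrightarrow> left_part a (join a x y) = x"
  by (rule left_join) (rule free_eqD)

lemma join_eq_0: "x \<in> free a \<Longrightarrow> join a x y = 0 \<longleftrightarrow> x = 0 \<and> y = 0"
proof
  assume "x \<in> free a" "join a x y = 0"
  then have "x = left_part a 0" "y = right_part a 0"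
    by (metis left_join_free, metis right_join)
  then show "x = 0 \<and> y = 0"
    by (simp add: left_part_def right_part_def fun_eq_iff vec_apply)
qed (simp add: join_linear)

text \<open>The syzygies of the concatenated generators are the direct sum of the two syzygy
  modules, so the induction descends. The cut-off changes from \<open>a\<close> to the number
  \<open>b1\<close> of generators of \<open>A\<close>, hence it is arbitrary in the
  induction.\<close>

lemma resolvable_direct_sum:
  assumes "resolvable n A" "resolvable n B" "A \<subseteq> free a"
  shows "resolvable n (direct_sum a A B)"
  using assms
proof (induction n arbitrary: A B a)
  case 0
  then show ?case by (auto simp: direct_sum_def join_linear)
next
  case (Suc n)
  obtain b1 g1 where A: "A = lincomb b1 g1 ` free b1" and n1: "resolvable n (syz b1 g1)"
    using Suc.prems by auto
  obtain b2 g2 where B: "B = lincomb b2 g2 ` free b2" and n2: "resolvable n (syz b2 g2)"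
    using Suc.prems by auto
  define g where "g = (\<lambda>c. if c < b1 then join a (g1 c) 0 else join a 0 (g2 (c - b1)))"
  have L: "lincomb (b1 + b2) g z
      = join a (lincomb b1 g1 (left_part b1 z)) (lincomb b2 g2 (right_part b1 z))" for z
    unfolding g_def by (rule lincomb_join)
  have "direct_sum a A B \<subseteq> lincomb (b1 + b2) g ` free (b1 + b2)"
  proof
    fix z assume "z \<in> direct_sum a A B"
    then obtain x y where xy: "x \<in> free b1" "y \<in> free b2"
      and z: "z = join a (lincomb b1 g1 x) (lincomb b2 g2 y)"
      by (auto simp: direct_sum_def A B)
    have "z = lincomb (b1 + b2) g (join b1 x y)"
      by (simp add: L xy z)
    then show "z \<in> lincomb (b1 + b2) g ` free (b1 + b2)"
      using join_free xy by blast
  qed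
  moreover have "lincomb (b1 + b2) g ` free (b1 + b2) \<subseteq> direct_sum a A B"
    using left_part_free right_part_free by (fastforce simp: direct_sum_def A B L)
  moreover have "syz (b1 + b2) g = direct_sum b1 (syz b1 g1) (syz b2 g2)"
  proof -
    have 0: "lincomb (b1 + b2) g z = 0 \<longleftrightarrow>
        lincomb b1 g1 (left_part b1 z) = 0 \<and> lincomb b2 g2 (right_part b1 z) = 0"
      if "z \<in> free (b1 + b2)" for z
      unfolding L using Suc.prems(3) A left_part_free[OF that] by (intro join_eq_0) auto
    show ?thesis
    proof (intro set_eqI iffI)
      fix z assume "z \<in> syz (b1 + b2) g"
      then have "left_part b1 z \<in> syz b1 g1" "right_part b1 z \<in> syz b2 g2"
        using 0 left_part_free right_part_free by (auto simp: syz_def)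
      then show "z \<in> direct_sum b1 (syz b1 g1) (syz b2 g2)"
        unfolding direct_sum_def by (metis (mono_tags, lifting) join_parts mem_Collect_eq)
    next
      fix z assume "z \<in> direct_sum b1 (syz b1 g1) (syz b2 g2)"
      then show "z \<in> syz (b1 + b2) g"
        using 0 join_free by (auto simp: direct_sum_def syz_def)
    qed
  qed
  moreover have "resolvable n (direct_sum b1 (syz b1 g1) (syz b2 g2))"
    using Suc.IH n1 n2 by (auto simp: syz_def)
  ultimately show ?case by (metis resolvable.simps(2) subset_antisym)
qed

text \<open>For exact \<open>0 \<rightarrow> A \<rightarrow> B \<rightarrow> C \<rightarrow> 0\<close> with covers \<open>F\<^sub>A \<rightarrow> A\<close> and \<open>F\<^sub>B \<rightarrow> B\<close>, the kernel of
  \<open>F\<^sub>B \<rightarrow> C\<close> is again the cokernel of an injection, namely \<open>syz A \<rightarrow> F\<^sub>A \<oplus> syz B\<close>.\<close>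

lemma resolvable_cokernel:
  assumes "resolvable m A" "resolvable n B"
    and "linear_on A \<phi>" "\<And>x. x \<in> A \<Longrightarrow> \<phi> x = 0 \<Longrightarrow> x = 0"
    and "linear_on B \<psi>" "\<phi> ` A = {x \<in> B. \<psi> x = 0}"
  shows "resolvable (max (Suc m) n) (\<psi> ` B)"
  using assms
proof (induction m arbitrary: n A B \<phi> \<psi>)
  case 0
  \<comment> \<open>\<open>A\<close> is zero here, so the kernel of \<psi> on \<open>B\<close> is
    zero and \<psi> is injective on \<open>B\<close>.\<close>
  have "\<phi> 0 = 0" using linear_on_0[OF 0(3) resolvable_submod[OF 0(1)]] .
  then have "resolvable n (\<psi> ` B)"
    using 0 by (intro resolvable_iso) auto
  then show ?case by (rule resolvable_mono) simp
next
  case (Suc m)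
  note lin\<phi> = Suc.prems(3) and lin\<psi> = Suc.prems(5)
  have subA: "submod A" and subB: "submod B"
    using Suc.prems(1,2) resolvable_submod by blast+
  \<comment> \<open>\<open>n\<close> may be 0; passing to length \<open>Suc (n - 1)\<close> ensures
    that \<open>B\<close> has a first cover.\<close>
  have "resolvable (Suc (n - 1)) B"
    using Suc.prems(2) by (rule resolvable_mono) simp
  then obtain b g where B: "B = lincomb b g ` free b" and rB: "resolvable (n - 1) (syz b g)"
    by auto
  obtain a e where A: "A = lincomb a e ` free a" and rA: "resolvable m (syz a e)"
    using Suc.prems by auto
  \<comment> \<open>The map \<phi> is lifted to the covers: each \<phi> (e c) has a preimage under
    \<open>lincomb b g\<close>, and \<open>H\<close> below extends this choice linearly.\<close>
  have "\<exists>h. \<forall>c<a. h c \<in> free b \<and> lincomb b g (h c) = \<phi> (e c)"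
  proof -
    have "\<exists>y. y \<in> free b \<and> lincomb b g y = \<phi> (e c)" if "c < a" for c
    proof -
      have "\<phi> (e c) \<in> B"
        using Suc.prems(6) generator_mem[OF that, of e] A by blast
      then show ?thesis by (auto simp: B)
    qed
    then show ?thesis by metis
  qed
  then obtain h where h: "\<And>c. c < a \<Longrightarrow> h c \<in> free b" "\<And>c. c < a \<Longrightarrow> lincomb b g (h c) = \<phi> (e c)"
    by blast
  define H where "H = lincomb a h"
  have H_free: "H x \<in> free b" if "x \<in> free a" for x
    unfolding H_def using submod_free h(1) that by (rule lincomb_mem)
  have gH: "lincomb b g (H x) = \<phi> (lincomb a e x)" if "x \<in> free a" for x
  proof -
    have "lincomb b g (H x) = lincomb a (\<lambda>c. \<phi> (e c)) x"
      unfolding H_def lincomb_lincomb by (rule lincomb_cong) (auto simp: h)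
    also have "\<dots> = \<phi> (lincomb a e x)"
      using linear_on_lincomb[OF lin\<phi> subA _ that] generator_mem A by metis
    finally show ?thesis .
  qed
  have \<phi>0: "\<phi> 0 = 0" using linear_on_0[OF lin\<phi> subA] .
  \<comment> \<open>\<open>K\<close> is the syzygy module of the generators \<psi> (g c) of the
    image. It will be the cokernel of \<phi>' from \<open>syz a e\<close> into \<open>B'\<close>, to
    which the induction hypothesis applies.\<close>
  define K where "K = {x \<in> free b. \<psi> (lincomb b g x) = 0}"
  define B' where "B' = direct_sum a (free a) (syz b g)"
  \<comment> \<open>The minus sign makes \<psi>' vanish on the image of \<phi>', and the first
    component alone shows that \<phi>' is injective.\<close>
  define \<phi>' where "\<phi>' x = join a x (- H x)" for x
  define \<psi>' where "\<psi>' z = H (left_part a z) + right_part a z" for z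
  \<comment> \<open>The free summand has length 1, hence the maximum with
    \<open>Suc 0\<close>.\<close>
  have "resolvable (max (Suc 0) (n - 1)) B'"
    unfolding B'_def
    by (intro resolvable_direct_sum resolvable_mono[OF resolvable_free] resolvable_mono[OF rB]) auto
  moreover have "linear_on (syz a e) \<phi>'"
    unfolding \<phi>'_def H_def linear_on_def
    by (auto simp: lincomb_add lincomb_smul join_def fun_eq_iff vec_apply)
  moreover have "x = 0" if "x \<in> syz a e" "\<phi>' x = 0" for x
    using that join_eq_0 by (auto simp: \<phi>'_def syz_def)
  moreover have "linear_on B' \<psi>'"
    unfolding \<psi>'_def H_def linear_on_def
    by (simp add: part_linear lincomb_add lincomb_smul smul_algebra algebra_simps)
  moreover have "\<phi>' ` syz a e = {z \<in> B'. \<psi>' z = 0}"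
  proof (intro set_eqI iffI)
    fix z assume "z \<in> \<phi>' ` syz a e"
    then obtain x where x: "x \<in> free a" "lincomb a e x = 0" "z = join a x (- H x)"
      by (auto simp: \<phi>'_def syz_def)
    have "- H x \<in> syz b g"
      using gH[OF x(1)] x \<phi>0 submodD(4)[OF submod_free H_free[OF x(1)]]
      by (simp add: syz_def lincomb_uminus)
    then show "z \<in> {z \<in> B'. \<psi>' z = 0}"
      using x by (auto simp: B'_def direct_sum_def \<psi>'_def)
  next
    fix z assume "z \<in> {z \<in> B'. \<psi>' z = 0}"
    then obtain x y where xy: "x \<in> free a" "y \<in> free b" "lincomb b g y = 0" "z = join a x y"
      and 0: "\<psi>' z = 0"
      by (auto simp: B'_def direct_sum_def syz_def)
    have "H x + y = 0" using 0 xy by (simp add: \<psi>'_def)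
    then have y: "y = - H x" by (simp add: eq_neg_iff_add_eq_0 add.commute)
    then have "\<phi> (lincomb a e x) = 0"
      using gH[OF xy(1)] xy(3) by (simp add: lincomb_uminus)
    then have "x \<in> syz a e"
      using Suc.prems(4) A xy(1) by (auto simp: syz_def)
    then show "z \<in> \<phi>' ` syz a e"
      using xy y by (auto simp: \<phi>'_def)
  qed
  ultimately have "resolvable (max (Suc m) (max (Suc 0) (n - 1))) (\<psi>' ` B')"
    using rA by (intro Suc.IH) auto
  moreover have "\<psi>' ` B' = K"
  proof (intro set_eqI iffI)
    fix x assume "x \<in> \<psi>' ` B'"
    then obtain u v where uv: "u \<in> free a" "v \<in> free b" "lincomb b g v = 0" "x = H u + v"
      by (auto simp: B'_def direct_sum_def syz_def \<psi>'_def)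
    then have "lincomb b g x = \<phi> (lincomb a e u)"
      by (simp add: lincomb_add gH)
    then show "x \<in> K"
      using uv Suc.prems(6) A submodD(2)[OF submod_free H_free[OF uv(1)] uv(2)]
      by (auto simp: K_def)
  next
    fix x assume "x \<in> K"
    then have x: "x \<in> free b" "lincomb b g x \<in> \<phi> ` A"
      using Suc.prems(6) B by (auto simp: K_def)
    then obtain u where u: "u \<in> free a" "lincomb b g x = \<phi> (lincomb a e u)"
      by (auto simp: A)
    define v where "v = x + - H u"
    have "v \<in> syz b g"
      using submodD(2)[OF submod_free x(1) submodD(4)[OF submod_free H_free[OF u(1)]]] u gH[OF u(1)]
      by (simp add: v_def syz_def lincomb_add lincomb_uminus del: add_uminus_conv_diff)
    moreover have "x = \<psi>' (join a u v)"
      using u by (simp add: \<psi>'_def v_def)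
    ultimately show "x \<in> \<psi>' ` B'"
      using u by (auto simp: B'_def direct_sum_def)
  qed
  moreover have "\<psi> (lincomb b g x) = lincomb b (\<lambda>c. \<psi> (g c)) x" if "x \<in> free b" for x
    using linear_on_lincomb[OF lin\<psi> subB _ that] generator_mem B by metis
  then have "\<psi> ` B = lincomb b (\<lambda>c. \<psi> (g c)) ` free b" "syz b (\<lambda>c. \<psi> (g c)) = K"
    by (auto simp: B K_def syz_def image_image)
  \<comment> \<open>The cover of the image adds one. Since \<open>Suc (Suc m)\<close> is at least 2,
    the maximum with \<open>Suc 0\<close> does not raise the bound.\<close>
  ultimately have "resolvable (Suc (max (Suc m) (max (Suc 0) (n - 1)))) (\<psi> ` B)"
    by (metis resolvable.simps(2))
  then show ?case by (rule resolvable_mono) auto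
qed

section \<open>Ideals as submodules of the free module of rank one\<close>

definition is_ideal :: "'a set \<Rightarrow> bool" where
  "is_ideal I \<longleftrightarrow> I \<subseteq> R \<and> 0 \<in> I \<and> (\<forall>p\<in>I. \<forall>q\<in>I. p + q \<in> I) \<and> (\<forall>r\<in>R. \<forall>p\<in>I. r * p \<in> I)"

lemma embed_free: "p \<in> R \<Longrightarrow> embed p \<in> free 1"
  by (simp add: embed_def free_def)

text \<open>\<open>resolvable_cokernel\<close> is applied to a \<mapsto> (y a, -a) and (p, q)
  \<mapsto> p + y q. The middle term has length \<open>max n m\<close>, so the extra one falls only
  on the length of \<open>I\<close>.\<close>

lemma resolvable_ideal_step:
  assumes "is_ideal I" "is_ideal J" "I \<subseteq> J" "y \<in> R"
    and colon: "\<And>p. p \<in> R \<Longrightarrow> y * p \<in> I \<Longrightarrow> p \<in> I"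
    and "resolvable n (embed ` I)" "resolvable m (embed ` J)"
  shows "resolvable (max (Suc n) m) (embed ` {p + y * q | p q. p \<in> I \<and> q \<in> J})"
proof -
  define B where "B = direct_sum 1 (embed ` I) (embed ` J)"
  define \<phi> where "\<phi> x = join 1 (smul y x) (- x)" for x :: "nat \<Rightarrow> 'a"
  define \<psi> where "\<psi> z = left_part 1 z + smul y (right_part 1 z)" for z :: "nat \<Rightarrow> 'a"
  have IR: "p \<in> I \<Longrightarrow> p \<in> R" for p using assms(1) by (auto simp: is_ideal_def)
  have \<psi>_eq: "\<psi> (join 1 (embed p) (embed q)) = embed (p + y * q)" if "p \<in> R" for p q
    by (simp add: \<psi>_def embed_free[OF that, simplified] embed_linear)
  have B_iff: "z \<in> B \<longleftrightarrow> (\<exists>p q. p \<in> I \<and> q \<in> J \<and> z = join 1 (embed p) (embed q))" for z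
    by (auto simp: B_def direct_sum_def)
  have neg: "p \<in> I \<Longrightarrow> - p \<in> I" for p
  proof -
    assume "p \<in> I"
    then have "-1 * p \<in> I" using assms(1) uminus_mem[OF one_mem] unfolding is_ideal_def by blast
    then show ?thesis by simp
  qed
  have "resolvable (max n m) B"
    unfolding B_def using assms(6,7) IR embed_free
    by (intro resolvable_direct_sum) (auto intro: resolvable_mono)
  moreover have "linear_on (embed ` I) \<phi>"
    unfolding \<phi>_def linear_on_def by (auto simp: join_def fun_eq_iff vec_apply algebra_simps)
  moreover have "x = 0" if "\<phi> x = 0" for x
  proof -
    have "right_part 1 (\<phi> x) = - x" by (simp add: \<phi>_def)
    then show ?thesis using that by (simp add: right_part_def fun_eq_iff vec_apply)
  qed
  moreover have "linear_on B \<psi>"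
    unfolding \<psi>_def linear_on_def by (simp add: part_linear smul_algebra algebra_simps)
  moreover have "\<phi> ` embed ` I = {z \<in> B. \<psi> z = 0}"
  proof (intro set_eqI iffI)
    fix z assume "z \<in> \<phi> ` embed ` I"
    then obtain p where p: "p \<in> I" "z = join 1 (embed (y * p)) (embed (- p))"
      by (auto simp: \<phi>_def embed_linear)
    have ypJ: "y * p \<in> I" "- p \<in> J" using p(1) neg assms by (auto simp: is_ideal_def)
    then have "\<psi> z = 0"
      using \<psi>_eq[of "y * p" "- p"] IR p(2) by (simp add: embed_linear(3))
    then show "z \<in> {z \<in> B. \<psi> z = 0}"
      using p(2) ypJ B_iff by blast
  next
    fix z assume "z \<in> {z \<in> B. \<psi> z = 0}"
    then obtain p q where pq: "p \<in> I" "q \<in> J" "z = join 1 (embed p) (embed q)" "\<psi> z = 0"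
      by (auto simp: B_iff)
    then have "embed (p + y * q) 0 = 0" using \<psi>_eq[of p q] IR by (simp add: vec_apply)
    \<comment> \<open>A kernel element has y (-q) = p in \<open>I\<close>, so \<open>colon\<close>
      puts -q into \<open>I\<close>, and (p, q) is the image of -q under \<phi>. This is exactness
      in the middle.\<close>
    then have *: "p = y * (- q)" by (simp add: eq_neg_iff_add_eq_0)
    have "q \<in> R" using pq assms(2) by (auto simp: is_ideal_def)
    with * colon[of "- q"] pq uminus_mem have q: "- q \<in> I" by auto
    have "embed p = smul y (embed (- q))"
      unfolding * by (rule embed_linear(2))
    then have "z = \<phi> (embed (- q))"
      using pq by (simp add: \<phi>_def embed_linear(4))
    then show "z \<in> \<phi> ` embed ` I" using q by blast
  qed
  ultimately have "resolvable (max (Suc n) (max n m)) (\<psi> ` B)"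
    using assms(6) by (intro resolvable_cokernel[of n "embed ` I" "max n m" B \<phi> \<psi>]) auto
  moreover have "\<psi> ` B = embed ` {p + y * q | p q. p \<in> I \<and> q \<in> J}"
  proof (intro set_eqI iffI)
    fix x assume "x \<in> \<psi> ` B"
    then obtain p q where "p \<in> I" "q \<in> J" "x = \<psi> (join 1 (embed p) (embed q))"
      by (auto simp: B_iff)
    then show "x \<in> embed ` {p + y * q | p q. p \<in> I \<and> q \<in> J}"
      using \<psi>_eq IR by blast
  next
    fix x assume "x \<in> embed ` {p + y * q | p q. p \<in> I \<and> q \<in> J}"
    then obtain p q where "p \<in> I" "q \<in> J" "x = embed (p + y * q)" by blast
    then show "x \<in> \<psi> ` B" using \<psi>_eq IR B_iff by (metis image_eqI)
  qed
  ultimately have "resolvable (max (Suc n) (max n m)) (embed ` {p + y * q | p q. p \<in> I \<and> q \<in> J})"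
    by (simp only:)
  then show ?thesis by (rule resolvable_mono) auto
qed

section \<open>From iterated syzygies to resolutions by matrices and \<open>pd\<close>\<close>

lemma resolvable_chain:
  assumes "resolvable n M" "M \<subseteq> free a"
  shows "\<exists>b g. b 0 = a \<and> (\<forall>i<n. \<forall>c<b (Suc i). g (Suc i) c \<in> free (b i)) \<and>
    (\<forall>i<n. (if i = 0 then M else syz (b i) (g i)) = lincomb (b (Suc i)) (g (Suc i)) ` free (b (Suc i))) \<and>
    (if n = 0 then M else syz (b n) (g n)) = {0}"
  using assms
proof (induction n arbitrary: M a)
  case 0
  then show ?case by (intro exI[of _ "\<lambda>_. a"]) simp
next
  case (Suc n)
  obtain b1 g1 where M: "M = lincomb b1 g1 ` free b1" and "resolvable n (syz b1 g1)"
    using Suc.prems by auto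
  then obtain b g where b0: "b 0 = b1"
    and g: "\<And>i c. i < n \<Longrightarrow> c < b (Suc i) \<Longrightarrow> g (Suc i) c \<in> free (b i)"
    and ex: "\<And>i. i < n \<Longrightarrow> (if i = 0 then syz b1 g1 else syz (b i) (g i))
        = lincomb (b (Suc i)) (g (Suc i)) ` free (b (Suc i))"
    and inj: "(if n = 0 then syz b1 g1 else syz (b n) (g n)) = {0}"
    using Suc.IH[of "syz b1 g1" b1] by (auto simp: syz_def)
  \<comment> \<open>The new cover is put in front: the ambient rank \<open>a\<close> gets index 0,
    the map \<open>g1\<close> gets index 1, and the inductive data move up by one.\<close>
  define b' where "b' i = (case i of 0 \<Rightarrow> a | Suc j \<Rightarrow> b j)" for i
  define g' where "g' i = (if i = Suc 0 then g1 else g (i - 1))" for i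
  have b': "b' 0 = a" "b' (Suc j) = b j" for j by (auto simp: b'_def)
  have g': "g' (Suc 0) = g1" "g' (Suc (Suc j)) = g (Suc j)" for j by (auto simp: g'_def)
  \<comment> \<open>For j = 0 this is the kernel of the new map \<open>g1\<close>, the module that
    the induction hypothesis was applied to.\<close>
  have syz': "syz (b j) (g' (Suc j)) = (if j = 0 then syz b1 g1 else syz (b j) (g j))" for j
    by (cases j) (auto simp: b' g' b0)
  have "g1 c \<in> free a" if "c < b1" for c
    using generator_mem[OF that, of g1] M Suc.prems(2) by auto
  then have "g' (Suc i) c \<in> free (b' i)" if "i < Suc n" "c < b' (Suc i)" for i c
    using that g b0 by (cases i) (auto simp: b' g')
  moreover have "(if i = 0 then M else syz (b' i) (g' i))
      = lincomb (b' (Suc i)) (g' (Suc i)) ` free (b' (Suc i))" if "i < Suc n" for i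
    using that ex by (cases i) (simp_all add: b' g' b0 M syz')
  moreover have "syz (b' (Suc n)) (g' (Suc n)) = {0}"
    using inj by (simp add: b' syz')
  ultimately show ?case
    using b'(1) by (intro exI[of _ b'] exI[of _ g']) simp
qed

end

lemma polyring_coeff_ring: "coeff_ring (polyring V :: ('v, 'k::comm_ring_1) mpoly set)"
proof
  fix p q :: "('v, 'k) mpoly" assume p: "p \<in> polyring V" and q: "q \<in> polyring V"
  show "p + q \<in> polyring V"
    using p q keys_add[of p q] by (auto simp: polyring_def)
  show "p * q \<in> polyring V"
    unfolding polyring_def
  proof (clarify)
    fix m v assume "m \<in> Poly_Mapping.keys (p * q)" "v \<in> Poly_Mapping.keys m"
    moreover then obtain s t where "m = s + t" and st: "s \<in> Poly_Mapping.keys p" "t \<in> Poly_Mapping.keys q"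
      using keys_mult[of p q] by blast
    ultimately have "v \<in> Poly_Mapping.keys s \<union> Poly_Mapping.keys t"
      using keys_add[of s t] by blast
    then show "v \<in> V"
      using p q st by (auto simp: polyring_def)
  qed
qed (auto simp: polyring_def in_keys_iff)

text \<open>\<open>pd\<close> is a least length, so a single resolution bounds it. At index 0 the
  ideal itself, as a set of vectors of length one, stands in place of a kernel.\<close>

lemma pd_le:
  assumes "coeff_ring.resolvable (polyring (verts G)) n
      (embed ` (edge_ideal G :: ('v, 'k::field) mpoly set))"
    and sub: "edge_ideal G \<subseteq> (polyring (verts G) :: ('v, 'k) mpoly set)"
  shows "pd TYPE('k) G \<le> n"
proof -
  interpret coeff_ring "polyring (verts G) :: ('v, 'k) mpoly set"
    by (rule polyring_coeff_ring)
  define M where "M = embed ` (edge_ideal G :: ('v, 'k) mpoly set)"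
  have free: "free_mod (verts G) = (free :: nat \<Rightarrow> (nat \<Rightarrow> ('v, 'k) mpoly) set)"
    by (auto simp: free_mod_def free_def fun_eq_iff)
  have M: "M = {x \<in> free 1. x 0 \<in> edge_ideal G}"
  proof -
    have "x = embed (x 0)" if "x \<in> free 1" for x
      using that by (auto simp: free_def embed_def fun_eq_iff)
    then show ?thesis using sub embed_free by (auto simp: M_def)
  qed
  have "resolvable n M" "M \<subseteq> free 1"
    using assms(1) M by (auto simp: M_def)
  from resolvable_chain[OF this] obtain b g where b0: "b 0 = 1"
    and g: "\<forall>i<n. \<forall>c<b (Suc i). g (Suc i) c \<in> free (b i)"
    and ex: "\<forall>i<n. (if i = 0 then M else syz (b i) (g i))
        = lincomb (b (Suc i)) (g (Suc i)) ` free (b (Suc i))"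
    and inj: "(if n = 0 then M else syz (b n) (g n)) = {0}"
    by blast
  define d where "d i r c = g i c r" for i r c
  \<comment> \<open>\<open>mat_apply\<close> returns 0 in the rows from \<open>b i\<close> on; the
    columns of \<open>g (Suc i)\<close> lie in \<open>free (b i)\<close> and vanish there
    too.\<close>
  have mat: "mat_apply (b i) (b (Suc i)) (d (Suc i)) = lincomb (b (Suc i)) (g (Suc i))" if "i < n" for i
    using g that by (auto simp: fun_eq_iff mat_apply_def lincomb_apply d_def free_def)
  have ker: "ker_at G b d i = (if i = 0 then M else syz (b i) (g i))" if "i \<le> n" for i
    using that mat[of "i - 1"]
    by (auto simp: ker_at_def M free syz_def zero_fun_def)
  have "is_matrix (verts G) (b (i - 1)) (b i) (d i)" if "i \<in> {1..n}" for i
    using that g[rule_format, of "i - 1"] by (auto simp: is_matrix_def d_def free_def)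
  moreover have "ker_at G b d i = mat_apply (b i) (b (Suc i)) (d (Suc i)) ` free_mod (verts G) (b (Suc i))"
    if "i < n" for i
    using that ker[of i] mat[of i] ex by (simp add: free)
  moreover have "ker_at G b d n = {\<lambda>_. 0}"
    using ker[of n] inj by (simp add: zero_fun_def)
  ultimately have "free_resolution G n b d"
    using b0 by (simp add: free_resolution_def)
  then show ?thesis
    unfolding pd_def by (intro Least_le) blast
qed

section \<open>Monomial ideals\<close>

definition monom_dvd :: "('v \<Rightarrow>\<^sub>0 nat) \<Rightarrow> ('v \<Rightarrow>\<^sub>0 nat) \<Rightarrow> bool" where
  "monom_dvd s m \<longleftrightarrow> (\<forall>v. Poly_Mapping.lookup s v \<le> Poly_Mapping.lookup m v)"

text \<open>For monomials \<open>T\<close> in the variables \<open>V\<close> this is the ideal they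
  generate, encoded by its membership test, so that colons and decompositions can be checked on
  exponents.\<close>

definition mono_ideal :: "'v set \<Rightarrow> ('v \<Rightarrow>\<^sub>0 nat) set \<Rightarrow> ('v, 'k::comm_ring_1) mpoly set" where
  "mono_ideal V T = {p \<in> polyring V. \<forall>m\<in>Poly_Mapping.keys p. \<exists>t\<in>T. monom_dvd t m}"

abbreviation var :: "'v \<Rightarrow> ('v \<Rightarrow>\<^sub>0 nat)" where
  "var y \<equiv> Poly_Mapping.single y 1"

lemma monom_dvd_add: "monom_dvd t m \<Longrightarrow> monom_dvd t (s + m)"
  by (simp add: monom_dvd_def lookup_add trans_le_add2)

lemma monom_dvd_trans: "monom_dvd s t \<Longrightarrow> monom_dvd t m \<Longrightarrow> monom_dvd s m"
  by (meson monom_dvd_def order_trans)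

lemma monom_dvd_diff: "monom_dvd t m \<Longrightarrow> m = t + (m - t)"
  by (rule poly_mapping_eqI) (simp add: monom_dvd_def lookup_add lookup_minus)

lemma mpoly_eq_sum_monomials:
  fixes p :: "'a \<Rightarrow>\<^sub>0 'b::comm_monoid_add"
  shows "p = (\<Sum>m\<in>Poly_Mapping.keys p. Poly_Mapping.single m (Poly_Mapping.lookup p m))"
  by (rule poly_mapping_eqI)
     (simp add: lookup_sum lookup_single when_def in_keys_iff)

lemma mpoly_in_closed_set:
  fixes p :: "'a \<Rightarrow>\<^sub>0 'b::comm_monoid_add"
  assumes "0 \<in> S" "\<And>p q. p \<in> S \<Longrightarrow> q \<in> S \<Longrightarrow> p + q \<in> S"
    and "\<And>m. m \<in> Poly_Mapping.keys p \<Longrightarrow> Poly_Mapping.single m (Poly_Mapping.lookup p m) \<in> S"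
  shows "p \<in> S"
proof -
  have "(\<Sum>m\<in>A. Poly_Mapping.single m (Poly_Mapping.lookup p m)) \<in> S" if "finite A" "A \<subseteq> Poly_Mapping.keys p" for A
    using that by (induction A rule: finite_induct) (auto intro: assms)
  then show ?thesis by (metis finite_keys mpoly_eq_sum_monomials order_refl)
qed

lemma Var_mult_single: "Var y * Poly_Mapping.single m c = Poly_Mapping.single (var y + m) c"
  by (simp add: Var_def mult_single)

lemma lookup_Var_mult: "Poly_Mapping.lookup (Var y * p) (var y + m) = Poly_Mapping.lookup p m"
proof -
  have "Var y * p = (\<Sum>k\<in>Poly_Mapping.keys p. Poly_Mapping.single (var y + k) (Poly_Mapping.lookup p k))"
    by (subst mpoly_eq_sum_monomials[of p]) (simp add: sum_distrib_left Var_mult_single)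
  then show ?thesis
    by (simp add: lookup_sum lookup_single when_def in_keys_iff)
qed

lemma keys_Var_mult: "Poly_Mapping.keys (Var y * p) \<subseteq> (+) (var y) ` Poly_Mapping.keys p"
  using keys_mult[of "Var y" p] by (auto simp: Var_def split: if_splits)

lemma Var_polyring: "y \<in> V \<Longrightarrow> Var y \<in> polyring V"
  by (auto simp: Var_def polyring_def)

lemma single_polyring: "p \<in> polyring V \<Longrightarrow> m \<in> Poly_Mapping.keys p \<Longrightarrow> Poly_Mapping.single m c \<in> polyring V"
  by (auto simp: polyring_def)

lemma is_ideal_mono_ideal:
  "coeff_ring.is_ideal (polyring V) (mono_ideal V T :: ('v, 'k::comm_ring_1) mpoly set)"
proof -
  interpret coeff_ring "polyring V :: ('v, 'k) mpoly set"
    by (rule polyring_coeff_ring)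
  have "p + q \<in> mono_ideal V T" if "p \<in> mono_ideal V T" "q \<in> mono_ideal V T" for p q :: "('v, 'k) mpoly"
    using that keys_add[of p q] add_mem by (auto simp: mono_ideal_def)
  moreover have "r * p \<in> mono_ideal V T" if p: "p \<in> mono_ideal V T" and "r \<in> polyring V" for r p :: "('v, 'k) mpoly"
  proof -
    have "\<exists>t\<in>T. monom_dvd t m" if "m \<in> Poly_Mapping.keys (r * p)" for m
      using that p keys_mult[of r p] monom_dvd_add by (fastforce simp: mono_ideal_def)
    then show ?thesis using that mult_mem by (auto simp: mono_ideal_def)
  qed
  moreover have "mono_ideal V T \<subseteq> (polyring V :: ('v, 'k) mpoly set)" "0 \<in> (mono_ideal V T :: ('v, 'k) mpoly set)"
    using zero_mem by (auto simp: mono_ideal_def)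
  ultimately show ?thesis
    unfolding is_ideal_def by blast
qed

lemma mono_ideal_mono:
  assumes "\<And>t. t \<in> T \<Longrightarrow> \<exists>u\<in>U. monom_dvd u t"
  shows "mono_ideal V T \<subseteq> mono_ideal V U"
  using assms monom_dvd_trans by (fastforce simp: mono_ideal_def)

text \<open>If t divides y m and does not involve y, then t divides m. Applied to each monomial m of
  \<open>p\<close>, this shows that y is a nonzerodivisor modulo the ideal.\<close>

lemma mono_ideal_colon_Var:
  assumes "\<And>t. t \<in> T \<Longrightarrow> Poly_Mapping.lookup t y = 0" "p \<in> polyring V" "Var y * p \<in> mono_ideal V T"
  shows "p \<in> mono_ideal V T"
proof -
  have "\<exists>t\<in>T. monom_dvd t m" if "m \<in> Poly_Mapping.keys p" for m
  proof -
    have "var y + m \<in> Poly_Mapping.keys (Var y * p)"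
      using that lookup_Var_mult[of y p m] by (simp add: in_keys_iff)
    then obtain t where t: "t \<in> T" "monom_dvd t (var y + m)"
      using assms(3) by (auto simp: mono_ideal_def)
    have "Poly_Mapping.lookup t v \<le> Poly_Mapping.lookup m v" for v
      using t(2) assms(1)[OF t(1)]
      by (cases "v = y") (auto simp: monom_dvd_def lookup_add lookup_single dest!: spec[of _ v])
    then show ?thesis using t(1) by (auto simp: monom_dvd_def)
  qed
  then show ?thesis using assms(2) by (simp add: mono_ideal_def)
qed

text \<open>Each term of a polynomial on the left is assigned to one generator dividing it, and the
  terms are collected by the kind of that generator.\<close>

lemma mono_ideal_Un_shift:
  assumes "y \<in> V"
  shows "(mono_ideal V (T \<union> (+) (var y) ` U) :: ('v, 'k::comm_ring_1) mpoly set)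
    = {p + Var y * q | p q. p \<in> mono_ideal V T \<and> q \<in> mono_ideal V U}" (is "?L = ?R")
proof
  interpret coeff_ring "polyring V :: ('v, 'k) mpoly set"
    by (rule polyring_coeff_ring)
  have idT: "is_ideal (mono_ideal V T)" and idU: "is_ideal (mono_ideal V U)"
    and id: "is_ideal (mono_ideal V (T \<union> (+) (var y) ` U))"
    by (rule is_ideal_mono_ideal)+
  show "?R \<subseteq> ?L"
  proof clarify
    fix p q :: "('v, 'k) mpoly" assume pq: "p \<in> mono_ideal V T" "q \<in> mono_ideal V U"
    have "Var y * q \<in> polyring V"
      using pq Var_polyring[OF assms] mult_mem by (auto simp: mono_ideal_def)
    moreover have "\<exists>t\<in>T \<union> (+) (var y) ` U. monom_dvd t m" if mk: "m \<in> Poly_Mapping.keys (Var y * q)" for m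
    proof -
      obtain k where k: "k \<in> Poly_Mapping.keys q" "m = var y + k"
        using mk keys_Var_mult[of y q] by auto
      then obtain u where "u \<in> U" "monom_dvd u k" using pq(2) by (auto simp: mono_ideal_def)
      then have "monom_dvd (var y + u) m"
        using k by (simp add: monom_dvd_def lookup_add)
      then show ?thesis using \<open>u \<in> U\<close> by blast
    qed
    ultimately have "Var y * q \<in> ?L" by (simp add: mono_ideal_def)
    moreover have "p \<in> ?L" using pq(1) by (auto simp: mono_ideal_def)
    ultimately show "p + Var y * q \<in> ?L" using id by (simp add: is_ideal_def)
  qed
  show "?L \<subseteq> ?R"
  proof
    fix p :: "('v, 'k) mpoly" assume p: "p \<in> ?L"
    show "p \<in> ?R"
    proof (rule mpoly_in_closed_set)
      show "0 \<in> ?R" using idT idU by (force simp: is_ideal_def)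
    next
      fix f g assume "f \<in> ?R" "g \<in> ?R"
      then obtain a b c d where "f = a + Var y * b" "g = c + Var y * d"
        and mem: "a \<in> mono_ideal V T" "c \<in> mono_ideal V T" "b \<in> mono_ideal V U" "d \<in> mono_ideal V U"
        by blast
      then have "f + g = (a + c) + Var y * (b + d)" by (simp add: algebra_simps)
      moreover have "a + c \<in> mono_ideal V T" "b + d \<in> mono_ideal V U"
        using mem idT idU by (auto simp: is_ideal_def)
      ultimately show "f + g \<in> ?R" by blast
    next
      fix m assume m: "m \<in> Poly_Mapping.keys p"
      define c where "c = Poly_Mapping.lookup p m"
      have pV: "p \<in> polyring V" using p by (simp add: mono_ideal_def)
      obtain t where t: "t \<in> T \<union> (+) (var y) ` U" "monom_dvd t m"
        using p m unfolding mono_ideal_def by blast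
      show "Poly_Mapping.single m (Poly_Mapping.lookup p m) \<in> ?R"
      proof (cases "t \<in> T")
        case True
        then have "Poly_Mapping.single m c \<in> mono_ideal V T"
          using single_polyring[OF pV m] t zero_mem by (auto simp: mono_ideal_def)
        moreover have "0 \<in> (mono_ideal V U :: ('v, 'k) mpoly set)" using idU by (simp add: is_ideal_def)
        moreover have "Poly_Mapping.single m c = Poly_Mapping.single m c + Var y * 0" by simp
        ultimately show ?thesis unfolding c_def by blast
      next
        case False
        then obtain u where u: "u \<in> U" "t = var y + u" using t by auto
        \<comment> \<open>\<open>k\<close> is the quotient m / y: since t = y u divides m, it equals
          u (m / t), a multiple of \<open>u\<close>.\<close>
        define k where "k = u + (m - t)"
        have m_eq: "m = var y + k"
          using monom_dvd_diff[OF t(2)] by (simp add: k_def u(2) add.assoc)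
        have "Poly_Mapping.keys k \<subseteq> Poly_Mapping.keys m"
          by (auto simp: m_eq in_keys_iff lookup_add)
        then have "Poly_Mapping.single k c \<in> polyring V"
          using pV m by (auto simp: polyring_def)
        moreover have "monom_dvd u k" by (simp add: k_def monom_dvd_def lookup_add)
        ultimately have "Poly_Mapping.single k c \<in> mono_ideal V U"
          using u zero_mem by (auto simp: mono_ideal_def)
        moreover have "0 \<in> (mono_ideal V T :: ('v, 'k) mpoly set)" using idT by (simp add: is_ideal_def)
        moreover have "Poly_Mapping.single m c = 0 + Var y * Poly_Mapping.single k c"
          by (simp add: Var_mult_single m_eq)
        ultimately show ?thesis unfolding c_def by blast
      qed
    qed
  qed
qed

abbreviation ideal_resolvable :: "'v set \<Rightarrow> nat \<Rightarrow> ('v, 'k::comm_ring_1) mpoly set \<Rightarrow> bool" where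
  "ideal_resolvable V n I \<equiv> coeff_ring.resolvable (polyring V) n (embed ` I)"

text \<open>Generators free of y give the colon condition of \<open>resolvable_ideal_step\<close>,
  and divisibility by members of \<open>U\<close> gives the inclusion of ideals.\<close>

lemma resolvable_mono_ideal_step:
  fixes T U :: "('v \<Rightarrow>\<^sub>0 nat) set"
  assumes "y \<in> V" "\<And>t. t \<in> T \<Longrightarrow> Poly_Mapping.lookup t y = 0"
    and "\<And>t. t \<in> T \<Longrightarrow> \<exists>u\<in>U. monom_dvd u t"
    and "ideal_resolvable V n (mono_ideal V T :: ('v, 'k::comm_ring_1) mpoly set)"
    and "ideal_resolvable V m (mono_ideal V U :: ('v, 'k) mpoly set)"
  shows "ideal_resolvable V (max (Suc n) m) (mono_ideal V (T \<union> (+) (var y) ` U) :: ('v, 'k) mpoly set)"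
  unfolding mono_ideal_Un_shift[OF assms(1)]
  by (rule coeff_ring.resolvable_ideal_step[OF polyring_coeff_ring is_ideal_mono_ideal is_ideal_mono_ideal
        mono_ideal_mono[OF assms(3)] Var_polyring[OF assms(1)] mono_ideal_colon_Var[OF assms(2)] assms(4,5)])

text \<open>Each variable is added by a step with \<open>U = {0}\<close>, whose ideal is the whole
  ring and has length 1, so the bound grows by one.\<close>

lemma resolvable_add_variables:
  fixes T :: "('v \<Rightarrow>\<^sub>0 nat) set"
  assumes "finite N" "N \<subseteq> V" "\<And>t y. t \<in> T \<Longrightarrow> y \<in> N \<Longrightarrow> Poly_Mapping.lookup t y = 0"
    and "ideal_resolvable V n (mono_ideal V T :: ('v, 'k::comm_ring_1) mpoly set)"
  shows "ideal_resolvable V (n + card N) (mono_ideal V (T \<union> var ` N) :: ('v, 'k) mpoly set)"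
  using assms
proof (induction N rule: finite_induct)
  case empty
  then show ?case by simp
next
  case (insert y N)
  interpret coeff_ring "polyring V :: ('v, 'k) mpoly set"
    by (rule polyring_coeff_ring)
  \<comment> \<open>The exponent vector 0 is the monomial 1, which divides every monomial.\<close>
  have "embed ` (mono_ideal V {0} :: ('v, 'k) mpoly set) = free 1"
  proof -
    have "x \<in> embed ` polyring V" if "x \<in> free 1" for x
    proof
      show "x = embed (x 0)" using that by (auto simp: free_def embed_def fun_eq_iff)
      show "x 0 \<in> polyring V" using that mem_R by blast
    qed
    then show ?thesis using embed_free by (auto simp: mono_ideal_def monom_dvd_def)
  qed
  then have 1: "ideal_resolvable V (Suc 0) (mono_ideal V {0} :: ('v, 'k) mpoly set)"
    using resolvable_free by metis
  \<comment> \<open>The variables added earlier differ from y, so y is still a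
    nonzerodivisor.\<close>
  have avoid: "Poly_Mapping.lookup t y = 0" if "t \<in> T \<union> var ` N" for t
    using that insert.prems(2) insert.hyps by (auto simp: lookup_single when_def)
  have "ideal_resolvable V (max (Suc (n + card N)) (Suc 0))
      (mono_ideal V ((T \<union> var ` N) \<union> (+) (var y) ` {0}) :: ('v, 'k) mpoly set)"
    using insert 1 by (intro resolvable_mono_ideal_step avoid) (auto simp: monom_dvd_def)
  then show ?case using insert.hyps by (simp add: Un_commute insert_commute del: resolvable.simps)
qed

section \<open>Edge ideals as monomial ideals\<close>

definition edge_monos :: "'v graph \<Rightarrow> ('v \<Rightarrow>\<^sub>0 nat) set" where
  "edge_monos G = (\<lambda>(u, v). var u + var v) ` edges G"

lemma edge_monos_iff: "t \<in> edge_monos G \<longleftrightarrow> (\<exists>u v. (u, v) \<in> edges G \<and> t = var u + var v)"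
  by (auto simp: edge_monos_def)

lemma simple_graphD:
  assumes "simple_graph G"
  shows "finite (verts G)" "finite (edges G)" "(u, v) \<in> edges G \<Longrightarrow> u \<in> verts G"
    "(u, v) \<in> edges G \<Longrightarrow> v \<in> verts G" "(u, v) \<in> edges G \<Longrightarrow> (v, u) \<in> edges G"
  using assms finite_subset[of "edges G" "verts G \<times> verts G"]
  by (auto simp: simple_graph_def sym_def)

lemma edge_ideal_eq_mono_ideal:
  assumes "simple_graph G"
  shows "edge_ideal G = (mono_ideal (verts G) (edge_monos G) :: ('v, 'k::comm_ring_1) mpoly set)"
proof
  let ?I = "mono_ideal (verts G) (edge_monos G) :: ('v, 'k) mpoly set"
  interpret coeff_ring "polyring (verts G) :: ('v, 'k) mpoly set"
    by (rule polyring_coeff_ring)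
  note fin = simple_graphD(2)[OF assms]
  have id: "is_ideal ?I" by (rule is_ideal_mono_ideal)
  have VV: "Var u * Var v = (Poly_Mapping.single (var u + var v) 1 :: ('v, 'k) mpoly)" for u v
    by (simp add: Var_def mult_single)
  have gen: "Var (fst e) * Var (snd e) \<in> ?I" if "e \<in> edges G" for e
  proof -
    obtain u v where e: "e = (u, v)" by force
    have "u \<in> verts G" "v \<in> verts G" using simple_graphD[OF assms] that e by auto
    then have "Var u * Var v \<in> (polyring (verts G) :: ('v, 'k) mpoly set)"
      by (intro mult_mem Var_polyring)
    moreover have "var u + var v \<in> edge_monos G"
      using that e edge_monos_iff by blast
    ultimately show ?thesis
      by (auto simp: e VV mono_ideal_def monom_dvd_def)
  qed
  show "edge_ideal G \<subseteq> ?I"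
  proof
    fix p :: "('v, 'k) mpoly" assume "p \<in> edge_ideal G"
    then obtain c where c: "\<And>e. e \<in> edges G \<Longrightarrow> c e \<in> polyring (verts G)"
      and p: "p = (\<Sum>e\<in>edges G. c e * (Var (fst e) * Var (snd e)))"
      by (auto simp: edge_ideal_def)
    have "(\<Sum>e\<in>A. c e * (Var (fst e) * Var (snd e))) \<in> ?I" if "finite A" "A \<subseteq> edges G" for A
      using that
    proof (induction A rule: finite_induct)
      case empty
      then show ?case using id by (simp add: is_ideal_def)
    next
      case (insert e A)
      then have "c e * (Var (fst e) * Var (snd e)) \<in> ?I"
        using id gen c by (auto simp: is_ideal_def)
      with insert show ?case using id by (auto simp: is_ideal_def)
    qed
    then show "p \<in> ?I" using fin p by simp
  qed
  show "?I \<subseteq> edge_ideal G"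
  proof
    fix p :: "('v, 'k) mpoly" assume p: "p \<in> ?I"
    show "p \<in> edge_ideal G"
    proof (rule mpoly_in_closed_set)
      show "0 \<in> (edge_ideal G :: ('v, 'k) mpoly set)"
        using zero_mem unfolding edge_ideal_def by (intro CollectI exI[of _ "\<lambda>_. 0"]) simp
    next
      fix f g :: "('v, 'k) mpoly" assume "f \<in> edge_ideal G" "g \<in> edge_ideal G"
      then obtain c d where "\<forall>e\<in>edges G. c e \<in> polyring (verts G)" "\<forall>e\<in>edges G. d e \<in> polyring (verts G)"
        "f = (\<Sum>e\<in>edges G. c e * (Var (fst e) * Var (snd e)))"
        "g = (\<Sum>e\<in>edges G. d e * (Var (fst e) * Var (snd e)))"
        unfolding edge_ideal_def by blast
      then show "f + g \<in> edge_ideal G"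
        using add_mem unfolding edge_ideal_def
        by (intro CollectI exI[of _ "\<lambda>e. c e + d e"]) (simp add: sum.distrib distrib_right)
    next
      fix m assume m: "m \<in> Poly_Mapping.keys p"
      define a where "a = Poly_Mapping.lookup p m"
      obtain t where "t \<in> edge_monos G" "monom_dvd t m"
        using p m unfolding mono_ideal_def by blast
      then obtain u v where uv: "(u, v) \<in> edges G" and dvd: "monom_dvd (var u + var v) m"
        unfolding edge_monos_iff by blast
      define k where "k = m - (var u + var v)"
      have m_eq: "m = (var u + var v) + k" using monom_dvd_diff[OF dvd] by (simp add: k_def)
      have "Poly_Mapping.keys k \<subseteq> Poly_Mapping.keys m"
        by (auto simp: m_eq in_keys_iff lookup_add)
      then have k: "Poly_Mapping.single k a \<in> polyring (verts G)"
        using p m by (auto simp: polyring_def mono_ideal_def)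
      \<comment> \<open>Only one orientation of the edge carries a coefficient; the reverse pair
        gets 0, so the term is not counted twice.\<close>
      define c where "c e = (if e = (u, v) then Poly_Mapping.single k a else 0)" for e
      have "(\<Sum>e\<in>edges G. c e * (Var (fst e) * Var (snd e)))
          = (\<Sum>e\<in>edges G. if e = (u, v) then Poly_Mapping.single k a * (Var u * Var v) else 0)"
        by (rule sum.cong) (auto simp: c_def)
      also have "\<dots> = Poly_Mapping.single m a"
        using fin uv by (simp add: VV mult_single m_eq add.commute)
      finally show "Poly_Mapping.single m (Poly_Mapping.lookup p m) \<in> edge_ideal G"
        using k zero_mem unfolding edge_ideal_def a_def[symmetric]
        by (intro CollectI exI[of _ c]) (simp add: c_def)
    qed
  qed
qed

section \<open>Induced subgraphs and the deletion of one vertex\<close>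

lemma induced_simps [simp]:
  "verts (induced H W) = verts H \<inter> W" "edges (induced H W) = edges H \<inter> (W \<times> W)"
  by (simp_all add: induced_def verts_def edges_def)

lemma simple_graph_induced: "simple_graph H \<Longrightarrow> simple_graph (induced H W)"
  by (auto simp: simple_graph_def sym_def irrefl_def)

lemma verts_del_vertex [simp]: "verts (del_vertex H x) = verts H - {x}"
  by (auto simp: del_vertex_def)

lemma edges_del_isolated: "simple_graph H \<Longrightarrow> edges (del_isolated H) = edges H"
  by (auto simp: del_isolated_def isolated_def dest: simple_graphD)

text \<open>The vertices outside \<open>W\<close> are removed one at a time, by induction over the
  finite set \<open>D\<close> of removed vertices.\<close>

lemma hereditary_induced:
  assumes "hereditary C" "G \<in> C" "simple_graph G"
  shows "induced G W \<in> C"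
proof -
  have "induced G (verts G - D) \<in> C" if "finite D" "D \<subseteq> verts G" for D
    using that
  proof (induction D rule: finite_induct)
    case empty
    have "induced G (verts G) = G"
      using assms(3) by (auto simp: induced_def simple_graph_def verts_def edges_def prod_eq_iff)
    then show ?case using assms(2) by simp
  next
    case (insert x D)
    let ?H = "induced G (verts G - D)"
    have "del_vertex ?H x \<in> C"
      using insert assms(1) by (auto simp: hereditary_def)
    moreover have "del_vertex ?H x = induced G (verts G - insert x D)"
      by (auto simp: del_vertex_def induced_def verts_def edges_def)
    ultimately show ?case by simp
  qed
  from this[of "verts G - W"] have "induced G (verts G - (verts G - W)) \<in> C"
    using simple_graphD(1)[OF assms(3)] by auto
  moreover have "induced G (verts G - (verts G - W)) = induced G W"
    using assms(3) by (auto simp: induced_def simple_graph_def verts_def edges_def)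
  ultimately show ?thesis by simp
qed

text \<open>\<open>T\<close> generates I(H - x), and \<open>U\<close> generates the ideal J of H -
  st x and the neighbours of x. Adjoining the neighbours as variables accounts for the degree in the
  bound.\<close>

lemma resolvable_graph_step:
  fixes H :: "'v graph"
  assumes H: "simple_graph H" and V: "verts H \<subseteq> V" and x: "x \<in> verts H"
    and n: "ideal_resolvable V n (mono_ideal V (edge_monos (del_vertex H x)) :: ('v, 'k::comm_ring_1) mpoly set)"
    and m: "ideal_resolvable V m (mono_ideal V (edge_monos (del_star H x)) :: ('v, 'k) mpoly set)"
  shows "ideal_resolvable V (max (Suc n) (m + card {u \<in> verts H. (x, u) \<in> edges H}))
    (mono_ideal V (edge_monos H) :: ('v, 'k) mpoly set)"
proof -
  define N where "N = {u \<in> verts H. (x, u) \<in> edges H}"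
  define T where "T = edge_monos (del_vertex H x)"
  define U where "U = edge_monos (del_star H x) \<union> var ` N"
  note simple = simple_graphD[OF H]
  have T_iff: "t \<in> T \<longleftrightarrow> (\<exists>u v. (u, v) \<in> edges H \<and> u \<noteq> x \<and> v \<noteq> x \<and> t = var u + var v)" for t
    using simple unfolding T_def edge_monos_iff del_vertex_def induced_simps by blast
  have S_iff: "t \<in> edge_monos (del_star H x) \<longleftrightarrow>
      (\<exists>u v. (u, v) \<in> edges H \<and> u \<notin> insert x N \<and> v \<notin> insert x N \<and> t = var u + var v)" for t
    using simple unfolding edge_monos_iff del_star_def star_verts_def N_def induced_simps
    by blast
  have N: "u \<in> N \<longleftrightarrow> (x, u) \<in> edges H" for u using simple by (auto simp: N_def)
  have dvdI: "monom_dvd (var u) (var u + var v)" "monom_dvd (var v) (var u + var v)" for u v :: 'v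
    by (simp_all add: monom_dvd_def lookup_add)
  have refl: "monom_dvd t t" for t :: "'v \<Rightarrow>\<^sub>0 nat" by (simp add: monom_dvd_def)
  have "ideal_resolvable V (m + card N) (mono_ideal V U :: ('v, 'k) mpoly set)"
    unfolding U_def
  proof (rule resolvable_add_variables[OF _ _ _ m])
    show "finite N" "N \<subseteq> V" using simple(1) V by (auto simp: N_def)
  next
    fix t y assume "t \<in> edge_monos (del_star H x)" "y \<in> N"
    then show "Poly_Mapping.lookup t y = 0"
      unfolding S_iff by (auto simp: lookup_add lookup_single when_def)
  qed
  moreover have "Poly_Mapping.lookup t x = 0" if "t \<in> T" for t
    using that unfolding T_iff by (auto simp: lookup_add lookup_single when_def)
  \<comment> \<open>An edge avoiding x either meets a neighbour of x, whose variable divides its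
    monomial, or survives in H - st x. Hence I(H - x) lies in J.\<close>
  moreover have "\<exists>u\<in>U. monom_dvd u t" if tT: "t \<in> T" for t
  proof -
    obtain u v where uv: "(u, v) \<in> edges H" "u \<noteq> x" "v \<noteq> x" "t = var u + var v"
      using tT unfolding T_iff by blast
    show ?thesis
    proof (cases "u \<in> N \<or> v \<in> N")
      case True
      then show ?thesis using dvdI uv(4) unfolding U_def by blast
    next
      case False
      then have "t \<in> edge_monos (del_star H x)" unfolding S_iff using uv by blast
      then show ?thesis using refl unfolding U_def by blast
    qed
  qed
  ultimately have "ideal_resolvable V (max (Suc n) (m + card N))
      (mono_ideal V (T \<union> (+) (var x) ` U) :: ('v, 'k) mpoly set)"
    using n x V unfolding T_def[symmetric] by (intro resolvable_mono_ideal_step) auto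
  \<comment> \<open>The generating sets may differ, since x times an edge of H - st x has degree
    three. The ideals agree because each generator is divisible by one from the other set.\<close>
  moreover have "mono_ideal V (T \<union> (+) (var x) ` U) = (mono_ideal V (edge_monos H) :: ('v, 'k) mpoly set)"
  proof (intro antisym mono_ideal_mono)
    fix t assume "t \<in> T \<union> (+) (var x) ` U"
    then consider "t \<in> T" | s where "s \<in> edge_monos (del_star H x)" "t = var x + s"
      | u where "u \<in> N" "t = var x + var u"
      unfolding U_def by blast
    then show "\<exists>u\<in>edge_monos H. monom_dvd u t"
    proof cases
      case 1
      then have "t \<in> edge_monos H" unfolding T_iff edge_monos_iff by blast
      then show ?thesis using refl by blast
    next
      case (2 s)
      then have "s \<in> edge_monos H"
        unfolding edge_monos_iff[of s H] using S_iff[of s] by blast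
      then show ?thesis using 2 refl monom_dvd_add by blast
    next
      case (3 u)
      then have "t \<in> edge_monos H" unfolding N edge_monos_iff by blast
      then show ?thesis using refl by blast
    qed
  next
    fix t assume "t \<in> edge_monos H"
    then obtain u v where uv: "(u, v) \<in> edges H" "t = var u + var v"
      unfolding edge_monos_iff by blast
    consider "u \<noteq> x" "v \<noteq> x" | "u = x" | "v = x" by blast
    then have "t \<in> T \<union> (+) (var x) ` U"
    proof cases
      case 1
      then have "t \<in> T" unfolding T_iff using uv by blast
      then show ?thesis by blast
    next
      case 2
      then have "v \<in> N" using uv N by blast
      then show ?thesis using uv 2 unfolding U_def by blast
    next
      case 3
      then have "u \<in> N" using uv N simple(5) by blast
      moreover have "t = var x + var u" using uv 3 by (simp add: add.commute)
      ultimately show ?thesis unfolding U_def by blast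
    qed
    then show "\<exists>s\<in>T \<union> (+) (var x) ` U. monom_dvd s t" using refl by blast
  qed
  ultimately show ?thesis unfolding N_def[symmetric] by simp
qed

section \<open>Iterated vertex deletion and the induction on the number of vertices\<close>

lemma del_vertices_simps [simp]:
  "del_vertices H [] = H" "del_vertices H (x # xs) = del_vertices (del_vertex H x) xs"
  by (simp_all add: del_vertices_def)

lemma del_vertices_induced:
  "simple_graph H \<Longrightarrow> del_vertices H vs = induced H (verts H - set vs)"
proof (induction vs arbitrary: H)
  case Nil
  then show ?case
    by (auto simp: induced_def simple_graph_def verts_def edges_def prod_eq_iff)
next
  case (Cons x vs)
  have "simple_graph (del_vertex H x)"
    unfolding del_vertex_def using Cons.prems by (rule simple_graph_induced)
  with Cons show ?case
    by (auto simp: del_vertex_def induced_def verts_def edges_def)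
qed

text \<open>In the star branch the degree pays for the neighbour variables of
  \<open>resolvable_graph_step\<close>, and the remaining 1 pays for the 1 in condition (2).\<close>

lemma card_del_star:
  assumes "simple_graph H" "x \<in> verts H"
  shows "card (verts (del_star H x)) + card {u \<in> verts H. (x, u) \<in> edges H} + 1 = card (verts H)"
proof -
  let ?N = "{u \<in> verts H. (x, u) \<in> edges H}"
  have fin: "finite (verts H)" and "x \<notin> ?N"
    using assms(1) by (auto simp: simple_graph_def irrefl_def)
  then have "card (insert x ?N) = card ?N + 1" by simp
  moreover have "card (verts H - insert x ?N) = card (verts H) - card (insert x ?N)"
    using fin assms(2) by (intro card_Diff_subset) auto
  moreover have "card (insert x ?N) \<le> card (verts H)"
    using fin assms(2) by (intro card_mono) auto
  moreover have "verts (del_star H x) = verts H - insert x ?N"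
    by (auto simp: del_star_def star_verts_def)
  ultimately show ?thesis by simp
qed

text \<open>\<open>F\<close> stands for the value of f at the starting graph. Conditions (2) and (3)
  compare every stage with this same value, so one constant serves the whole induction, which works
  back from the last graph. Each deletion of a vertex costs one in length and one in the vertex
  count.\<close>

lemma resolvable_vertex_sequence:
  fixes V :: "'v set" and H :: "'v graph" and F :: real
  defines "I \<equiv> \<lambda>H. mono_ideal V (edge_monos H) :: ('v, 'k::comm_ring_1) mpoly set"
  assumes "simple_graph H" "verts H \<subseteq> V"
    and "\<forall>i<length vs. vs ! i \<in> verts (del_vertices H (take i vs))"
    and "\<forall>i<length vs. \<exists>m. ideal_resolvable V m (I (del_star (del_vertices H (take i vs)) (vs ! i))) \<and>
        real m \<le> real (card (verts (del_star (del_vertices H (take i vs)) (vs ! i)))) + 1 - F"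
    and "\<exists>n. ideal_resolvable V n (I (del_vertices H vs)) \<and> real n \<le> real (card (verts (del_vertices H vs))) - F"
  shows "\<exists>n. ideal_resolvable V n (I H) \<and> real n \<le> real (card (verts H)) - F"
  using assms(2-)
proof (induction vs arbitrary: H)
  case Nil
  then show ?case by simp
next
  case (Cons x vs)
  have x: "x \<in> verts H" using Cons.prems(3) by force
  have "simple_graph (del_vertex H x)"
    unfolding del_vertex_def using Cons.prems(1) by (rule simple_graph_induced)
  then have "\<exists>n. ideal_resolvable V n (I (del_vertex H x)) \<and> real n \<le> real (card (verts (del_vertex H x))) - F"
  proof (rule Cons.IH)
    show "verts (del_vertex H x) \<subseteq> V" using Cons.prems(2) by auto
  next
    show "\<forall>i<length vs. vs ! i \<in> verts (del_vertices (del_vertex H x) (take i vs))"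
      using Cons.prems(3) by force
  next
    show "\<forall>i<length vs. \<exists>m. ideal_resolvable V m (I (del_star (del_vertices (del_vertex H x) (take i vs)) (vs ! i))) \<and>
        real m \<le> real (card (verts (del_star (del_vertices (del_vertex H x) (take i vs)) (vs ! i)))) + 1 - F"
    proof (intro allI impI)
      fix i assume "i < length vs"
      then show "\<exists>m. ideal_resolvable V m (I (del_star (del_vertices (del_vertex H x) (take i vs)) (vs ! i))) \<and>
        real m \<le> real (card (verts (del_star (del_vertices (del_vertex H x) (take i vs)) (vs ! i)))) + 1 - F"
        using Cons.prems(4)[rule_format, of "Suc i"] by simp
    qed
  next
    show "\<exists>n. ideal_resolvable V n (I (del_vertices (del_vertex H x) vs)) \<and>
        real n \<le> real (card (verts (del_vertices (del_vertex H x) vs))) - F"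
      using Cons.prems(5) by simp
  qed
  then obtain n where n: "ideal_resolvable V n (I (del_vertex H x))"
    "real n \<le> real (card (verts (del_vertex H x))) - F" by blast
  from Cons.prems(4)[rule_format, of 0] obtain m where m: "ideal_resolvable V m (I (del_star H x))"
    "real m \<le> real (card (verts (del_star H x))) + 1 - F" by auto
  let ?l = "max (Suc n) (m + card {u \<in> verts H. (x, u) \<in> edges H})"
  have "ideal_resolvable V ?l (I H)"
    using Cons.prems(1,2) x n(1) m(1) unfolding I_def by (rule resolvable_graph_step)
  moreover have "card (verts (del_vertex H x)) + 1 = card (verts H)"
    using card_Suc_Diff1[OF simple_graphD(1)[OF Cons.prems(1)] x] by simp
  then have "real ?l \<le> real (card (verts H)) - F"
    using n(2) m(2) card_del_star[OF Cons.prems(1) x] by linarith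
  ultimately show ?case by blast
qed

theorem theorem3p1:
  fixes C :: "'v graph set" and f :: "'v graph \<Rightarrow> real"
  assumes graphs: "\<forall>G\<in>C. simple_graph G"
    and her: "hereditary C"
    and cond1: "\<forall>G\<in>C. edges G = {} \<longrightarrow> f G \<le> real (card (verts G))"
    and cond23: "\<forall>G\<in>C. edges G \<noteq> {} \<longrightarrow>
       (\<exists>vs. vs \<noteq> [] \<and>
          (\<forall>i<length vs. vs ! i \<in> verts (del_vertices G (take i vs))) \<and>
          (\<forall>i<length vs. f (del_star (del_vertices G (take i vs)) (vs ! i)) + 1 \<ge> f G) \<and>
          f (del_isolated (del_vertices G vs))
            + real (card (isolated (del_vertices G vs))) \<ge> f G)"
    and G: "G \<in> C"
  shows "real (pd TYPE('k::field) G) \<le> real (card (verts G)) - f G"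
proof -
  define V where "V = verts G"
  define I where "I H = (mono_ideal V (edge_monos H) :: ('v, 'k) mpoly set)" for H
  have induced_C: "induced H W \<in> C" if "H \<in> C" for H W
    using hereditary_induced her graphs that by blast
  \<comment> \<open>The ring stays the one on the vertices of \<open>G\<close>, while the bound
    counts only the vertices of \<open>H\<close>.\<close>
  have "\<exists>n. ideal_resolvable V n (I H) \<and> real n \<le> real (card (verts H)) - f H"
    if "H \<in> C" "verts H \<subseteq> V" for H
    using that
  proof (induction "card (verts H)" arbitrary: H rule: less_induct)
    case less
    have simple: "simple_graph H" using graphs less.prems by blast
    show ?case
    proof (cases "edges H = {}")
      case True
      \<comment> \<open>Without edges length 0 suffices, and condition (1) says that the bound is
        nonnegative.\<close>
      then have "I H = {0}"
        by (auto simp: I_def edge_monos_def mono_ideal_def polyring_def)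
      then have "ideal_resolvable V 0 (I H)"
        by (simp add: coeff_ring.resolvable.simps[OF polyring_coeff_ring] embed_linear)
      then show ?thesis using cond1 less.prems True by fastforce
    next
      case False
      then obtain vs where vs: "vs \<noteq> []"
        and mem: "\<forall>i<length vs. vs ! i \<in> verts (del_vertices H (take i vs))"
        and star: "\<forall>i<length vs. f (del_star (del_vertices H (take i vs)) (vs ! i)) + 1 \<ge> f H"
        and iso: "f (del_isolated (del_vertices H vs)) + real (card (isolated (del_vertices H vs))) \<ge> f H"
        using cond23 less.prems by blast
      have del_C: "del_vertices H xs \<in> C" for xs
        using induced_C less.prems(1) by (simp add: del_vertices_induced[OF simple])
      have fin: "finite (verts H)" using simple_graphD(1)[OF simple] .
      have smaller: "\<exists>n. ideal_resolvable V n (I K) \<and> real n \<le> real (card (verts K)) - f K"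
        if "K \<in> C" "verts K \<subset> verts H" for K
        using less.hyps[OF psubset_card_mono[OF fin that(2)] that(1)] that(2) less.prems(2) by blast
      have "\<exists>m. ideal_resolvable V m (I (del_star (del_vertices H (take i vs)) (vs ! i))) \<and>
          real m \<le> real (card (verts (del_star (del_vertices H (take i vs)) (vs ! i)))) + 1 - f H"
        if i: "i < length vs" for i
      proof -
        define K where "K = del_star (del_vertices H (take i vs)) (vs ! i)"
        have "K \<in> C" unfolding K_def del_star_def by (rule induced_C[OF del_C])
        \<comment> \<open>\<open>vs ! i\<close> belongs to \<open>H\<close> but not to
          \<open>K\<close>, so the induction hypothesis applies to \<open>K\<close>.\<close>
        moreover have "verts K \<subseteq> verts H" "vs ! i \<notin> verts K" "vs ! i \<in> verts H"
          using mem i by (auto simp: K_def del_star_def star_verts_def del_vertices_induced[OF simple])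
        ultimately obtain m where "ideal_resolvable V m (I K)" "real m \<le> real (card (verts K)) - f K"
          using smaller by blast
        moreover have "f K + 1 \<ge> f H" using star i by (simp add: K_def)
        ultimately show ?thesis unfolding K_def[symmetric] by (intro exI[of _ m]) auto
      qed
      moreover have "\<exists>n. ideal_resolvable V n (I (del_vertices H vs)) \<and>
          real n \<le> real (card (verts (del_vertices H vs))) - f H"
      proof -
        define K where "K = del_vertices H vs"
        have sK: "simple_graph K" using graphs del_C by (simp add: K_def)
        \<comment> \<open>The sequence is nonempty, so at least its first vertex is lost and
          \<open>K\<close> has fewer vertices than \<open>H\<close>.\<close>
        have "vs ! 0 \<in> verts H" "vs ! 0 \<in> set vs" using mem vs by auto
        then have "verts K \<subset> verts H"
          by (auto simp: K_def del_vertices_induced[OF simple])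
        moreover have "verts (del_isolated K) = verts K - isolated K"
          by (auto simp: del_isolated_def)
        moreover have "del_isolated K \<in> C"
          unfolding del_isolated_def K_def by (rule induced_C[OF del_C])
        ultimately obtain n where n: "ideal_resolvable V n (I (del_isolated K))"
          "real n \<le> real (card (verts K - isolated K)) - f (del_isolated K)"
          using smaller by (metis Diff_subset subset_psubset_trans)
        have "isolated K \<subseteq> verts K" by (auto simp: isolated_def)
        then have "card (verts K - isolated K) + card (isolated K) = card (verts K)"
          using simple_graphD(1)[OF sK] by (metis card_Diff_subset card_mono finite_subset le_add_diff_inverse2)
        then have "real n \<le> real (card (verts K)) - f H"
          using n(2) iso by (simp add: K_def)
        \<comment> \<open>Isolated vertices lie on no edge, so they leave the ideal unchanged and
          only raise the vertex count, by the summand in condition (3).\<close>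
        moreover have "I (del_isolated K) = I K"
          by (simp add: I_def edge_monos_def edges_del_isolated[OF sK])
        ultimately show ?thesis using n(1) unfolding K_def by metis
      qed
      ultimately show ?thesis
        using resolvable_vertex_sequence[OF simple less.prems(2) mem] unfolding I_def by blast
    qed
  qed
  then obtain n where n: "ideal_resolvable V n (I G)" "real n \<le> real (card (verts G)) - f G"
    using G V_def by blast
  have eq: "edge_ideal G = I G"
    using edge_ideal_eq_mono_ideal graphs G unfolding I_def V_def by blast
  then have "edge_ideal G \<subseteq> (polyring (verts G) :: ('v, 'k) mpoly set)"
    by (auto simp: I_def mono_ideal_def V_def)
  then have "pd TYPE('k) G \<le> n"
    using n(1) eq unfolding V_def by (intro pd_le) auto
  then show ?thesis using n(2) by linarith
qed

end
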